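(* Let $H_0\colon D(H_0)\subseteq\mathcal{H}\to\mathcal{H}$ be a densely defined, closed, skew-symmetric linear operator on a Hilbert space $\mathcal{H}$, and let $(\Omega,\mathcal{G}_1,\mathcal{G}_2,F,\omega)$ be the boundary system for $H_0$ given by $\mathcal{G}_1:=\ker(1-H_0^\star)$, $\mathcal{G}_2:=\ker(1+H_0^\star)$, $\Omega$ the standard symmetric form on $\mathcal{H}\oplus\mathcal{H}$, $\omega$ the standard unitary form on $\mathcal{G}_1\oplus\mathcal{G}_2$, and $F\colon\operatorname{Graph}(H_0^\star)\to\mathcal{G}_1\oplus\mathcal{G}_2$, $F(x,H_0^\star x)=(\sqrt{2}P_1x,\sqrt{2}P_2x)$, where $P_j\colon D(H_0^\star)\to\mathcal{G}_j$, $j\in\{1,2\}$, is the projection according to the direct decomposition $D(H_0^\star)=D(H_0)\,\dot+\,\mathcal{G}_1\,\dot+\,\mathcal{G}_2$. Then $H:=H_0^\star|_{D(H_0)\dot{+}\mathcal{G}_2}$ is a maximal dissipative extension of $H_0$.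
   Context: $H_0$ is skew-symmetric if $H_0\subseteq -H_0^\star$. An operator $H$ on $\mathcal{H}$ is dissipative if $\operatorname{Re}(Hx,x)_{\mathcal{H}}\leqslant 0$ for all $x\in D(H)$; it is maximal dissipative if it is dissipative and has no proper dissipative extension (for densely defined dissipative $H$ this is equivalent to $1-H$ being surjective). Boundary system for $H_0$: a quintuple $(\Omega,\mathcal{G}_1,\mathcal{G}_2,F,\omega)$ where $\Omega$ is a sesquilinear form on $\mathcal{H}\oplus\mathcal{H}$, $\mathcal{G}_1,\mathcal{G}_2$ are Hilbert spaces, $\omega$ is a sesquilinear form on $\mathcal{G}_1\oplus\mathcal{G}_2$, and $F\colon\operatorname{Graph}(H_0^{\star})\to\mathcal{G}_1\oplus\mathcal{G}_2$ is a surjective map such that $\Omega((x,H_0^{\star}x),(y,H_0^{\star}y))=\omega(F(x,H_0^{\star}x),F(y,H_0^{\star}y))$ for all $x,y\in D(H_0^{\star})$. Standard symmetric form on $\mathcal{H}\oplus\mathcal{H}$: $\Omega((x,y),(u,v))=(x,v)_{\mathcal{H}}+(y,u)_{\mathcal{H}}$. Standard unitary form on $\mathcal{G}_1\oplus\mathcal{G}_2$: $\omega((x,y),(u,v))=(x,u)_{\mathcal{G}_1}-(y,v)_{\mathcal{G}_2}$. Here $\mathcal{G}_1,\mathcal{G}_2$ carry the inner product of $\mathcal{H}$.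
   Formalization: With the stated convention H_0 ⊆ -H_0^*, H_0^* acts as -H_0 on D(H_0), so H is proved to be maximal dissipative and an extension of -H_0 rather than of H_0; the literal claim fails e.g. for H_0 = i on the complex numbers, where H = -i. *)

theory Defs
  imports "HOL-Analysis.Analysis"
begin

section \<open>Complex Hilbert spaces\<close>

text \<open>The library only has real inner product spaces.  The inner product below is linear in
  its first and antilinear in its second argument.\<close>

class complex_hilbert = banach +
  fixes scaleC :: "complex \<Rightarrow> 'a \<Rightarrow> 'a" (infixr "*\<^sub>C" 75)
    and cinner :: "'a \<Rightarrow> 'a \<Rightarrow> complex"
  assumes scaleC_of_real: "scaleC (complex_of_real r) x = scaleR r x"
    and scaleC_add_right: "scaleC c (x + y) = scaleC c x + scaleC c y"
    and scaleC_add_left: "scaleC (c + d) x = scaleC c x + scaleC d x"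
    and scaleC_scaleC: "scaleC c (scaleC d x) = scaleC (c * d) x"
    and cinner_commute: "cinner x y = cnj (cinner y x)"
    and cinner_add_left: "cinner (x + y) z = cinner x z + cinner y z"
    and cinner_scaleC_left: "cinner (scaleC c x) y = c * cinner x y"
    and cinner_self: "cinner x x = complex_of_real ((norm x)\<^sup>2)"

instantiation complex :: complex_hilbert
begin
definition scaleC_complex :: "complex \<Rightarrow> complex \<Rightarrow> complex" where
  "scaleC_complex c x = c * x"
definition cinner_complex :: "complex \<Rightarrow> complex \<Rightarrow> complex" where
  "cinner_complex x y = x * cnj y"
instance
  by standard
    (auto simp: scaleC_complex_def cinner_complex_def algebra_simps scaleR_conv_of_real
      complex_norm_square[symmetric])
end

text \<open>The orthogonal sum of two Hilbert spaces; the library's norm on pairs is the matching one.\<close>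

instantiation prod :: (complex_hilbert, complex_hilbert) complex_hilbert
begin
definition scaleC_prod :: "complex \<Rightarrow> 'a \<times> 'b \<Rightarrow> 'a \<times> 'b" where
  "scaleC_prod c p = (c *\<^sub>C fst p, c *\<^sub>C snd p)"
definition cinner_prod :: "'a \<times> 'b \<Rightarrow> 'a \<times> 'b \<Rightarrow> complex" where
  "cinner_prod p q = cinner (fst p) (fst q) + cinner (snd p) (snd q)"
instance
proof
  fix x y :: "'a \<times> 'b"
  show "cinner x y = cnj (cinner y x)"
    unfolding cinner_prod_def
    by (simp add: cinner_commute[of "fst x" "fst y"] cinner_commute[of "snd x" "snd y"])
  show "cinner x x = complex_of_real ((norm x)\<^sup>2)"
    by (simp add: cinner_prod_def cinner_self norm_prod_def)
qed (auto simp: scaleC_prod_def cinner_prod_def scaleC_of_real scaleC_add_right scaleC_add_left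
      scaleC_scaleC cinner_add_left cinner_scaleC_left algebra_simps prod_eq_iff)
end

definition csubspace :: "'a::complex_hilbert set \<Rightarrow> bool" where
  "csubspace S \<longleftrightarrow> 0 \<in> S \<and> (\<forall>x\<in>S. \<forall>y\<in>S. x + y \<in> S) \<and> (\<forall>c. \<forall>x\<in>S. c *\<^sub>C x \<in> S)"


section \<open>Unbounded operators\<close>

text \<open>A linear operator is represented by its graph, so its domain is \<^const>\<open>Domain\<close>, extension
  is inclusion, and the operator is closed iff the graph is \<^const>\<open>closed\<close>.\<close>

definition linear_op :: "('a::complex_hilbert \<times> 'b::complex_hilbert) set \<Rightarrow> bool" where
  "linear_op A \<longleftrightarrow> csubspace A \<and> single_valued A"

definition densely_defined :: "('a::complex_hilbert \<times> 'b::complex_hilbert) set \<Rightarrow> bool" where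
  "densely_defined A \<longleftrightarrow> closure (Domain A) = UNIV"

definition op_uminus :: "('a \<times> 'b::complex_hilbert) set \<Rightarrow> ('a \<times> 'b) set" where
  "op_uminus A = {(x, - y) | x y. (x, y) \<in> A}"

definition op_plus :: "('a \<times> 'b::complex_hilbert) set \<Rightarrow> ('a \<times> 'b) set \<Rightarrow> ('a \<times> 'b) set" where
  "op_plus A B = {(x, y + z) | x y z. (x, y) \<in> A \<and> (x, z) \<in> B}"

definition op_kernel :: "('a \<times> 'b::complex_hilbert) set \<Rightarrow> 'a set" where
  "op_kernel A = {x. (x, 0) \<in> A}"

definition op_restrict :: "('a \<times> 'b) set \<Rightarrow> 'a set \<Rightarrow> ('a \<times> 'b) set" where
  "op_restrict A D = {(x, y). (x, y) \<in> A \<and> x \<in> D}"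

text \<open>Single-valued precisely when \<open>A\<close> is densely defined.\<close>

definition adjoint_op :: "('a::complex_hilbert \<times> 'b::complex_hilbert) set \<Rightarrow> ('b \<times> 'a) set" where
  "adjoint_op A = {(y, z). \<forall>(x, w)\<in>A. cinner w y = cinner x z}"

definition skew_symmetric :: "('a::complex_hilbert \<times> 'a) set \<Rightarrow> bool" where
  "skew_symmetric A \<longleftrightarrow> A \<subseteq> op_uminus (adjoint_op A)"

definition dissipative :: "('a::complex_hilbert \<times> 'a) set \<Rightarrow> bool" where
  "dissipative A \<longleftrightarrow> linear_op A \<and> (\<forall>(x, y)\<in>A. Re (cinner y x) \<le> 0)"

definition maximal_dissipative :: "('a::complex_hilbert \<times> 'a) set \<Rightarrow> bool" where
  "maximal_dissipative A \<longleftrightarrow> dissipative A \<and> (\<forall>B. dissipative B \<and> A \<subseteq> B \<longrightarrow> B = A)"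


section \<open>Boundary systems\<close>

definition sesquilinear_on ::
    "'a::complex_hilbert set \<Rightarrow> ('a \<Rightarrow> 'a \<Rightarrow> complex) \<Rightarrow> bool" where
  "sesquilinear_on S s \<longleftrightarrow>
     (\<forall>x\<in>S. \<forall>y\<in>S. \<forall>z\<in>S. s (x + y) z = s x z + s y z \<and> s z (x + y) = s z x + s z y) \<and>
     (\<forall>c. \<forall>x\<in>S. \<forall>y\<in>S. s (c *\<^sub>C x) y = c * s x y \<and> s x (c *\<^sub>C y) = cnj c * s x y)"

text \<open>The boundary spaces are Hilbert spaces given as closed subspaces of ambient ones, which
  carry the inherited inner product.  Only the values of \<open>F\<close> on the graph of the adjoint and of
  \<open>\<omega>\<close> on \<open>G1 \<times> G2\<close> matter.\<close>

definition boundary_system ::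
    "('h::complex_hilbert \<times> 'h) set \<Rightarrow>
     ('h \<times> 'h \<Rightarrow> 'h \<times> 'h \<Rightarrow> complex) \<Rightarrow> 'a::complex_hilbert set \<Rightarrow> 'b::complex_hilbert set \<Rightarrow>
     ('h \<times> 'h \<Rightarrow> 'a \<times> 'b) \<Rightarrow> ('a \<times> 'b \<Rightarrow> 'a \<times> 'b \<Rightarrow> complex) \<Rightarrow> bool" where
  "boundary_system H0 \<Omega> G1 G2 F \<omega> \<longleftrightarrow>
     sesquilinear_on UNIV \<Omega> \<and>
     csubspace G1 \<and> closed G1 \<and> csubspace G2 \<and> closed G2 \<and>
     sesquilinear_on (G1 \<times> G2) \<omega> \<and>
     F ` adjoint_op H0 = G1 \<times> G2 \<and>
     (\<forall>p\<in>adjoint_op H0. \<forall>q\<in>adjoint_op H0. \<Omega> p q = \<omega> (F p) (F q))"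

definition standard_symmetric_form ::
    "'a::complex_hilbert \<times> 'a \<Rightarrow> 'a \<times> 'a \<Rightarrow> complex" where
  "standard_symmetric_form = (\<lambda>(x, y) (u, v). cinner x v + cinner y u)"

definition standard_unitary_form ::
    "'a::complex_hilbert \<times> 'b::complex_hilbert \<Rightarrow> 'a \<times> 'b \<Rightarrow> complex" where
  "standard_unitary_form = (\<lambda>(x, y) (u, v). cinner x u - cinner y v)"

definition direct_decomposition ::
    "'a::complex_hilbert set \<Rightarrow> 'a set \<Rightarrow> 'a set \<Rightarrow> 'a set \<Rightarrow> bool" where
  "direct_decomposition V A B C \<longleftrightarrow>
     csubspace A \<and> csubspace B \<and> csubspace C \<and> V = {a + b + c | a b c. a \<in> A \<and> b \<in> B \<and> c \<in> C} \<and>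
     (\<forall>a\<in>A. \<forall>b\<in>B. \<forall>c\<in>C. a + b + c = 0 \<longrightarrow> a = 0 \<and> b = 0 \<and> c = 0)"

definition direct_components ::
    "'a::complex_hilbert set \<Rightarrow> 'a set \<Rightarrow> 'a set \<Rightarrow> 'a \<Rightarrow> 'a \<times> 'a \<times> 'a" where
  "direct_components A B C x = (THE (a, b, c). a \<in> A \<and> b \<in> B \<and> c \<in> C \<and> x = a + b + c)"


section \<open>The decomposition of the domain of the adjoint\<close>

lemma scaleC_minus1: "(- 1) *\<^sub>C x = - (x::'a::complex_hilbert)"
  using scaleC_of_real[of "-1" x] by simp

lemma cinner_add_right: "cinner x (y + z) = cinner x y + cinner x (z::'a::complex_hilbert)"
  unfolding cinner_commute[of x] by (simp add: cinner_add_left)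

lemma cinner_scaleC_right: "cinner x (c *\<^sub>C y) = cnj c * cinner x (y::'a::complex_hilbert)"
  unfolding cinner_commute[of x] by (simp add: cinner_scaleC_left)

lemma cinner_minus_left: "cinner (- x) y = - cinner x (y::'a::complex_hilbert)"
  using cinner_scaleC_left[of "-1" x y] by (simp add: scaleC_minus1)

lemma cinner_minus_right: "cinner x (- y) = - cinner x (y::'a::complex_hilbert)"
  using cinner_scaleC_right[of x "-1" y] by (simp add: scaleC_minus1)

lemma cinner_diff_left: "cinner (x - y) z = cinner x z - cinner y (z::'a::complex_hilbert)"
  using cinner_add_left[of x "-y" z] by (simp add: cinner_minus_left)

lemma cinner_diff_right: "cinner x (y - z) = cinner x y - cinner x (z::'a::complex_hilbert)"
  using cinner_add_right[of x y "-z"] by (simp add: cinner_minus_right)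

lemma cinner_zero_left: "cinner 0 (x::'a::complex_hilbert) = 0"
  using cinner_diff_left[of 0 0 x] by simp

lemma cinner_zero_right: "cinner (x::'a::complex_hilbert) 0 = 0"
  using cinner_diff_right[of x 0 0] by simp

lemmas cinner_simps = cinner_add_left cinner_add_right cinner_minus_left cinner_minus_right
  cinner_diff_left cinner_diff_right cinner_zero_left cinner_zero_right
  cinner_scaleC_left cinner_scaleC_right

lemma scaleC_zero: "c *\<^sub>C (0::'a::complex_hilbert) = 0"
  using scaleC_add_right[of c 0 "0::'a"] by simp

lemma scaleC_minus_right: "c *\<^sub>C (- x) = - (c *\<^sub>C (x::'a::complex_hilbert))"
  using scaleC_add_right[of c x "-x"] by (simp add: scaleC_zero eq_neg_iff_add_eq_0 add.commute)

lemma norm_sq_Re: "(norm (x::'a::complex_hilbert))\<^sup>2 = Re (cinner x x)"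
  by (simp add: cinner_self)

lemma Re_cinner_commute: "Re (cinner y x) = Re (cinner x (y::'a::complex_hilbert))"
  by (simp add: cinner_commute[of y x])

lemma norm_add_sq:
  "(norm (x + y))\<^sup>2 = (norm x)\<^sup>2 + (norm y)\<^sup>2 + 2 * Re (cinner x (y::'a::complex_hilbert))"
  by (simp add: norm_sq_Re cinner_simps Re_cinner_commute[of y x])

lemma norm_diff_sq:
  "(norm (x - y))\<^sup>2 = (norm x)\<^sup>2 + (norm y)\<^sup>2 - 2 * Re (cinner x (y::'a::complex_hilbert))"
  by (simp add: norm_sq_Re cinner_simps Re_cinner_commute[of y x])

lemma parallelogram:
  "(norm (x + y))\<^sup>2 + (norm (x - y))\<^sup>2 = 2 * (norm x)\<^sup>2 + 2 * (norm (y::'a::complex_hilbert))\<^sup>2"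
  by (simp add: norm_add_sq norm_diff_sq)

lemma cmod_sq: "(complex_of_real (cmod c))\<^sup>2 = c * cnj c"
  by (metis complex_norm_square of_real_power)

lemma norm_scaleC: "norm (c *\<^sub>C (x::'a::complex_hilbert)) = cmod c * norm x"
proof -
  have "complex_of_real ((norm (c *\<^sub>C x))\<^sup>2) = complex_of_real ((cmod c * norm x)\<^sup>2)"
    unfolding cinner_self[symmetric] cinner_simps
    by (simp add: cinner_self power_mult_distrib cmod_sq mult.commute[of "cnj c"])
  then show ?thesis
    by (metis of_real_eq_iff norm_ge_zero mult_nonneg_nonneg power2_eq_iff_nonneg)
qed

lemma csubspace_diff:
  assumes "csubspace S" "x \<in> S" "y \<in> S" shows "x - y \<in> S"
proof -
  have "x + (-1) *\<^sub>C y \<in> S" using assms unfolding csubspace_def by blast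
  then show ?thesis by (simp add: scaleC_minus1)
qed

lemma csubspace_scaleC: "csubspace S \<Longrightarrow> x \<in> S \<Longrightarrow> c *\<^sub>C x \<in> S"
  unfolding csubspace_def by blast

lemma csubspace_zero: "csubspace S \<Longrightarrow> 0 \<in> S"
  unfolding csubspace_def by blast

lemma csubspace_scaleR:
  assumes "csubspace S" "x \<in> S" shows "r *\<^sub>R x \<in> S"
  using assms unfolding csubspace_def by (metis scaleC_of_real)

lemma projection_exists:
  fixes S :: "'a::complex_hilbert set"
  assumes S: "csubspace S" "closed S"
  obtains p where "p \<in> S" "\<And>s. s \<in> S \<Longrightarrow> cinner (z - p) s = 0"
proof -
  define d where "d = Inf ((\<lambda>s. (norm (z - s))\<^sup>2) ` S)"
  have bdd: "bdd_below ((\<lambda>s. (norm (z - s))\<^sup>2) ` S)" by (rule bdd_belowI[of _ 0]) auto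
  have ne: "S \<noteq> {}" using S unfolding csubspace_def by auto
  have d_le: "d \<le> (norm (z - s))\<^sup>2" if "s \<in> S" for s
    unfolding d_def using that bdd by (intro cInf_lower) auto
  have "\<exists>s\<in>S. (norm (z - s))\<^sup>2 < d + inverse (real (Suc n))" for n
  proof -
    have "Inf ((\<lambda>s. (norm (z - s))\<^sup>2) ` S) < d + inverse (real (Suc n))"
      unfolding d_def by simp
    then show ?thesis using cInf_lessD[of "(\<lambda>s. (norm (z - s))\<^sup>2) ` S"] ne by auto
  qed
  then obtain f where fS: "\<And>n. f n \<in> S"
    and f: "\<And>n. (norm (z - f n))\<^sup>2 < d + inverse (real (Suc n))" by metis
  have gap: "(norm (f m - f n))\<^sup>2 \<le> 2 * inverse (real (Suc m)) + 2 * inverse (real (Suc n))" for m n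
  proof -
    have mid: "(1/2) *\<^sub>R (f m + f n) \<in> S"
      using S fS csubspace_scaleR unfolding csubspace_def by metis
    have e: "(z - f m) + (z - f n) = 2 *\<^sub>R (z - (1/2) *\<^sub>R (f m + f n))"
      by (simp add: algebra_simps scaleR_2)
    have "(norm ((z - f m) + (z - f n)))\<^sup>2 = 4 * (norm (z - (1/2) *\<^sub>R (f m + f n)))\<^sup>2"
      unfolding e by (simp add: power_mult_distrib)
    then have "(norm ((z - f m) + (z - f n)))\<^sup>2 \<ge> 4 * d" using d_le[OF mid] by simp
    moreover have "(norm ((z - f m) - (z - f n)))\<^sup>2 = (norm (f m - f n))\<^sup>2"
      by (simp add: norm_minus_commute)
    ultimately show ?thesis
      using parallelogram[of "z - f m" "z - f n"] f[of m] f[of n] by linarith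
  qed
  have "Cauchy f"
  proof (rule metric_CauchyI)
    fix e :: real assume e: "0 < e"
    obtain N where N: "inverse (real (Suc N)) < e\<^sup>2 / 4"
      using reals_Archimedean[of "e\<^sup>2/4"] e by auto
    show "\<exists>M. \<forall>m\<ge>M. \<forall>n\<ge>M. dist (f m) (f n) < e"
    proof (intro exI allI impI)
      fix m n assume "N \<le> m" "N \<le> n"
      then have "inverse (real (Suc m)) \<le> inverse (real (Suc N))"
        "inverse (real (Suc n)) \<le> inverse (real (Suc N))" by auto
      then have "(norm (f m - f n))\<^sup>2 < e\<^sup>2" using gap[of m n] N by linarith
      then show "dist (f m) (f n) < e" using e
        by (simp add: dist_norm power2_less_imp_less)
    qed
  qed
  then obtain p where p: "f \<longlonglongrightarrow> p" using Cauchy_convergent convergent_def by blast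
  have pS: "p \<in> S" using S(2) fS p closed_sequentially by blast
  have pd: "(norm (z - p))\<^sup>2 \<le> d"
  proof (rule LIMSEQ_le)
    show "(\<lambda>n. (norm (z - f n))\<^sup>2) \<longlonglongrightarrow> (norm (z - p))\<^sup>2" by (intro tendsto_intros p)
    show "(\<lambda>n. d + inverse (real (Suc n))) \<longlonglongrightarrow> d"
      using tendsto_add[OF tendsto_const LIMSEQ_inverse_real_of_nat] by simp
    show "\<exists>N. \<forall>n\<ge>N. (norm (z - f n))\<^sup>2 \<le> d + inverse (real (Suc n))"
      using f less_imp_le by blast
  qed
  have "cinner (z - p) s = 0" if s: "s \<in> S" for s
  proof (cases "s = 0")
    case False
    define a where "a = cinner (z - p) s"
    define c where "c = a / complex_of_real ((norm s)\<^sup>2)"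
    have n0: "(norm s)\<^sup>2 > 0" using False by simp
    have "p + c *\<^sub>C s \<in> S" using S pS s unfolding csubspace_def by blast
    then have "(norm (z - p))\<^sup>2 \<le> (norm ((z - p) - c *\<^sub>C s))\<^sup>2"
      using d_le[of "p + c *\<^sub>C s"] pd unfolding diff_diff_eq by linarith
    then have "2 * Re (cinner (z - p) (c *\<^sub>C s)) \<le> (cmod c)\<^sup>2 * (norm s)\<^sup>2"
      by (simp add: norm_diff_sq norm_scaleC power_mult_distrib)
    moreover have "cinner (z - p) (c *\<^sub>C s) = complex_of_real ((cmod a)\<^sup>2 / (norm s)\<^sup>2)"
      unfolding cinner_scaleC_right a_def[symmetric] c_def
      by (simp add: cmod_sq mult.commute)
    moreover have "(cmod c)\<^sup>2 * (norm s)\<^sup>2 = (cmod a)\<^sup>2 / (norm s)\<^sup>2"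
      using n0 unfolding c_def by (simp add: norm_divide norm_mult power2_eq_square)
    ultimately have "(cmod a)\<^sup>2 / (norm s)\<^sup>2 \<le> 0" by simp
    then show ?thesis using n0 unfolding a_def by (simp add: divide_le_0_iff)
  qed (simp add: cinner_simps)
  with pS that show ?thesis by blast
qed

lemma tendsto_cinner_left:
  assumes "f \<longlonglongrightarrow> (l::'a::complex_hilbert)" shows "(\<lambda>n. cinner (f n) y) \<longlonglongrightarrow> cinner l y"
proof -
  have add: "cinner (u + v) y = cinner u y + cinner v y" for u v by (rule cinner_add_left)
  have scale: "cinner (r *\<^sub>R u) y = r *\<^sub>R cinner u y" for r u
    unfolding scaleC_of_real[of r u, symmetric] cinner_simps
    by (simp add: scaleR_conv_of_real)
  have CS: "cmod (cinner u y) \<le> norm u * norm y" for u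
  proof (cases "y = 0")
    case False
    define a where "a = cinner u y"
    define c where "c = a / complex_of_real ((norm y)\<^sup>2)"
    have n0: "(norm y)\<^sup>2 > 0" using False by simp
    have "0 \<le> (norm (u - c *\<^sub>C y))\<^sup>2" by simp
    then have "2 * Re (cinner u (c *\<^sub>C y)) \<le> (norm u)\<^sup>2 + (cmod c)\<^sup>2 * (norm y)\<^sup>2"
      by (simp add: norm_diff_sq norm_scaleC power_mult_distrib)
    moreover have "cinner u (c *\<^sub>C y) = complex_of_real ((cmod a)\<^sup>2 / (norm y)\<^sup>2)"
      unfolding cinner_scaleC_right a_def[symmetric] c_def
      by (simp add: cmod_sq mult.commute)
    moreover have "(cmod c)\<^sup>2 * (norm y)\<^sup>2 = (cmod a)\<^sup>2 / (norm y)\<^sup>2"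
      using n0 unfolding c_def by (simp add: norm_divide norm_mult power2_eq_square)
    ultimately have "(cmod a)\<^sup>2 / (norm y)\<^sup>2 \<le> (norm u)\<^sup>2" by simp
    then have "(cmod a)\<^sup>2 \<le> (norm u * norm y)\<^sup>2"
      using n0 by (simp add: divide_le_eq power_mult_distrib)
    then show ?thesis unfolding a_def by (rule power2_le_imp_le) simp
  qed (simp add: cinner_simps)
  have "bounded_linear (\<lambda>u. cinner u y)"
    by (rule bounded_linear_intro[OF add scale CS])
  then show ?thesis using assms by (rule bounded_linear.tendsto)
qed

lemma tendsto_cinner_right:
  assumes "f \<longlonglongrightarrow> (l::'a::complex_hilbert)" shows "(\<lambda>n. cinner y (f n)) \<longlonglongrightarrow> cinner y l"
  unfolding cinner_commute[of y] by (intro tendsto_cnj tendsto_cinner_left assms)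

lemma adjoint_op_iff:
  "(y, z) \<in> adjoint_op A \<longleftrightarrow> (\<forall>x w. (x, w) \<in> A \<longrightarrow> cinner w y = cinner x z)"
  unfolding adjoint_op_def by auto

lemma adjoint_op_add:
  "(y, z) \<in> adjoint_op A \<Longrightarrow> (y', z') \<in> adjoint_op A \<Longrightarrow> (y + y', z + z') \<in> adjoint_op A"
  unfolding adjoint_op_iff by (simp add: cinner_simps)

lemma adjoint_op_scaleC:
  "(y, z) \<in> adjoint_op A \<Longrightarrow> (c *\<^sub>C y, c *\<^sub>C z) \<in> adjoint_op A"
  unfolding adjoint_op_iff by (simp add: cinner_simps)

lemma csubspace_adjoint_op: "csubspace (adjoint_op A)"
  unfolding csubspace_def
  by (auto simp: adjoint_op_add scaleC_prod_def adjoint_op_scaleC)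
    (auto simp: zero_prod_def adjoint_op_iff cinner_simps)

lemma single_valued_adjoint_op:
  assumes "densely_defined A" shows "single_valued (adjoint_op A)"
proof (rule single_valuedI)
  fix y z z' assume yz: "(y, z) \<in> adjoint_op A" "(y, z') \<in> adjoint_op A"
  have "z - z' \<in> closure (Domain A)" using assms unfolding densely_defined_def by simp
  then obtain f where f: "\<And>n. f n \<in> Domain A" "f \<longlonglongrightarrow> z - z'"
    unfolding closure_sequential by blast
  have "cinner (f n) (z - z') = 0" for n
  proof -
    obtain w where "(f n, w) \<in> A" using f(1)[of n] by blast
    then have "cinner w y = cinner (f n) z" "cinner w y = cinner (f n) z'"
      using yz unfolding adjoint_op_iff by blast+
    then show ?thesis by (simp add: cinner_simps)
  qed
  then have "(\<lambda>n. 0) \<longlonglongrightarrow> cinner (z - z') (z - z')" using tendsto_cinner_left[OF f(2), of "z - z'"] by simp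
  then have "cinner (z - z') (z - z') = 0" using LIMSEQ_unique tendsto_const by blast
  then show "z = z'" by (simp add: cinner_self)
qed

lemma closed_adjoint_op: "closed (adjoint_op A)"
  unfolding closed_sequential_limits
proof (intro allI impI, elim conjE)
  fix f l assume f: "\<forall>n. f n \<in> adjoint_op A" "f \<longlonglongrightarrow> l"
  have 1: "(\<lambda>n. fst (f n)) \<longlonglongrightarrow> fst l" "(\<lambda>n. snd (f n)) \<longlonglongrightarrow> snd l"
    using f(2) by (auto intro: tendsto_fst tendsto_snd)
  have "cinner w (fst l) = cinner x (snd l)" if xw: "(x, w) \<in> A" for x w
  proof -
    have "cinner w (fst (f n)) = cinner x (snd (f n))" for n
      using f(1) xw adjoint_op_iff[of "fst (f n)" "snd (f n)" A] by auto
    then show ?thesis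
      using tendsto_cinner_right[OF 1(1), of w] tendsto_cinner_right[OF 1(2), of x] LIMSEQ_unique
      by simp
  qed
  then have "(fst l, snd l) \<in> adjoint_op A" unfolding adjoint_op_iff by blast
  then show "l \<in> adjoint_op A" by simp
qed

lemma kernel_one_minus:
  "op_kernel (op_plus Id (op_uminus A)) = {x::'a::complex_hilbert. (x, x) \<in> A}"
  unfolding op_kernel_def op_plus_def op_uminus_def
  by (auto simp flip: eq_neg_iff_add_eq_0) force

lemma kernel_one_plus:
  "op_kernel (op_plus Id A) = {x::'a::complex_hilbert. (x, - x) \<in> A}"
  unfolding op_kernel_def op_plus_def
  by (auto simp: add_eq_0_iff)

lemma skew_symmetric_adjoint:
  assumes "skew_symmetric A" "(x, y) \<in> A" shows "(x, - y) \<in> adjoint_op A"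
  using assms unfolding skew_symmetric_def op_uminus_def by fastforce

text \<open>For skew-symmetric \<open>H0\<close> the adjoint restricts to \<open>- H0\<close>, not \<open>H0\<close>, on the domain of \<open>H0\<close>:
  its restrictions can extend \<open>- H0\<close>, but extend \<open>H0\<close> only if \<open>H0\<close> vanishes.\<close>

lemma skew_symmetric_eq_zero_if_extended_by_adjoint:
  assumes "densely_defined A" "skew_symmetric A" "A \<subseteq> op_restrict (adjoint_op A) D" "(x, y) \<in> A"
  shows "y = 0"
proof -
  have "(x, - y) \<in> adjoint_op A" using assms skew_symmetric_adjoint by blast
  moreover have "(x, y) \<in> adjoint_op A" using assms unfolding op_restrict_def by blast
  ultimately have "- y = y"
    using single_valued_adjoint_op[OF assms(1)] unfolding single_valued_def by blast
  then have "2 *\<^sub>R y = 0" by (simp add: scaleR_2 neg_eq_iff_add_eq_0)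
  then show ?thesis by simp
qed

locale skew_symmetric_op =
  fixes H0 :: "('a::complex_hilbert \<times> 'a) set"
  assumes lin: "linear_op H0" and dense: "densely_defined H0"
    and closed_H0: "closed H0" and skew: "skew_symmetric H0"
begin

abbreviation "G1 \<equiv> op_kernel (op_plus Id (op_uminus (adjoint_op H0)))"
abbreviation "G2 \<equiv> op_kernel (op_plus Id (adjoint_op H0))"

lemma G1_eq: "G1 = {x. (x, x) \<in> adjoint_op H0}"
  by (rule kernel_one_minus)

lemma G2_eq: "G2 = {x. (x, - x) \<in> adjoint_op H0}"
  by (rule kernel_one_plus)

lemma decomposition:
  "direct_decomposition (Domain (adjoint_op H0)) (Domain H0) G1 G2"
proof -
  let ?A = "adjoint_op H0"
  have sv: "z = z'" if "(y, z) \<in> ?A" "(y, z') \<in> ?A" for y z z'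
    using that single_valued_adjoint_op[OF dense] unfolding single_valued_def by blast
  have sub: "csubspace H0" using lin unfolding linear_op_def by blast
  have subA: "csubspace ?A" by (rule csubspace_adjoint_op)
  define K where "K = op_uminus H0"
  have K_iff: "(x, y) \<in> K \<longleftrightarrow> (x, - y) \<in> H0" for x y
    unfolding K_def op_uminus_def by force
  have KA: "(x, y) \<in> ?A" if "(x, y) \<in> K" for x y
    using that skew_symmetric_adjoint[OF skew] K_iff by fastforce
  have subK: "csubspace K"
    unfolding csubspace_def
  proof (intro conjI ballI allI)
    show "0 \<in> K" using sub unfolding csubspace_def zero_prod_def K_iff by simp
    fix p assume p: "p \<in> K"
    obtain x y where xy: "p = (x, y)" by force
    { fix q assume q: "q \<in> K"
      obtain u v where uv: "q = (u, v)" by force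
      have "(x, - y) + (u, - v) \<in> H0" using p q xy uv K_iff sub unfolding csubspace_def by blast
      then show "p + q \<in> K" using xy uv K_iff by (simp add: add.commute) }
    fix c
    have "c *\<^sub>C (x, - y) \<in> H0" using p xy K_iff sub unfolding csubspace_def by blast
    then show "c *\<^sub>C p \<in> K" using xy K_iff by (simp add: scaleC_prod_def scaleC_minus_right)
  qed
  have closedK: "closed K"
  proof -
    have "K = (\<lambda>p. (fst p, - snd p)) -` H0" using K_iff by force
    moreover have "continuous_on UNIV (\<lambda>p::'a\<times>'a. (fst p, - snd p))"
      by (intro continuous_intros)
    ultimately show ?thesis using closed_H0 closed_vimage by blast
  qed
  have D0: "csubspace (Domain H0)"
    unfolding csubspace_def
  proof (intro conjI ballI allI)
    show "0 \<in> Domain H0" using sub unfolding csubspace_def zero_prod_def by blast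
    fix x assume "x \<in> Domain H0"
    then obtain y where xy: "(x, y) \<in> H0" by blast
    { fix u assume "u \<in> Domain H0"
      then obtain v where "(u, v) \<in> H0" by blast
      then have "(x, y) + (u, v) \<in> H0" using xy sub unfolding csubspace_def by blast
      then show "x + u \<in> Domain H0" by auto }
    fix c
    have "c *\<^sub>C (x, y) \<in> H0" using xy sub unfolding csubspace_def by blast
    then show "c *\<^sub>C x \<in> Domain H0" by (auto simp: scaleC_prod_def)
  qed
  have G1: "csubspace G1" unfolding G1_eq csubspace_def
    using subA[unfolded csubspace_def zero_prod_def]
    by (auto simp: adjoint_op_add adjoint_op_scaleC)
  have G2: "csubspace G2" unfolding G2_eq csubspace_def
  proof (intro conjI ballI allI)
    show "0 \<in> {x. (x, - x) \<in> ?A}" using subA unfolding csubspace_def zero_prod_def by simp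
    fix x assume x: "x \<in> {x. (x, - x) \<in> ?A}"
    { fix u assume "u \<in> {x. (x, - x) \<in> ?A}"
      then show "x + u \<in> {x. (x, - x) \<in> ?A}" using x adjoint_op_add[of x "-x" H0 u "-u"]
        by (simp add: add.commute) }
    fix c
    show "c *\<^sub>C x \<in> {x. (x, - x) \<in> ?A}" using x adjoint_op_scaleC[of x "-x" H0 c]
      by (simp add: scaleC_minus_right)
  qed
  have D0A: "\<exists>y. (x, y) \<in> ?A \<and> (x, y) \<in> K" if "x \<in> Domain H0" for x
  proof -
    from that obtain y where "(x, y) \<in> H0" by blast
    then have "(x, - y) \<in> K" using K_iff by simp
    then show ?thesis using KA by blast
  qed
  have "Domain ?A = {a + b + c | a b c. a \<in> Domain H0 \<and> b \<in> G1 \<and> c \<in> G2}"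
  proof (intro equalityI subsetI)
    fix x assume "x \<in> Domain ?A"
    then obtain y where xy: "(x, y) \<in> ?A" by blast
    obtain p where p: "p \<in> K" "\<And>s. s \<in> K \<Longrightarrow> cinner ((x, y) - p) s = 0"
      using projection_exists[OF subK closedK, of "(x, y)"] by blast
    obtain x0 y0 where p0: "p = (x0, y0)" by force
    define u v where "u = x - x0" and "v = y - y0"
    have uv: "(u, v) \<in> ?A"
      using csubspace_diff[OF subA xy KA[of x0 y0]] p p0 unfolding u_def v_def by simp
    have vu: "(v, u) \<in> ?A"
      unfolding adjoint_op_iff
    proof (intro allI impI)
      fix a b assume "(a, b) \<in> H0"
      then have "(a, - b) \<in> K" using K_iff by simp
      then have "cinner (u, v) (a, - b) = 0" using p p0 u_def v_def by fastforce
      then have "cinner u a = cinner v b" by (simp add: cinner_prod_def cinner_simps)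
      then show "cinner b v = cinner a u" by (metis cinner_commute)
    qed
    define b c where "b = (1/2) *\<^sub>R (u + v)" and "c = (1/2) *\<^sub>R (u - v)"
    have "(1/2) *\<^sub>R ((u, v) + (v, u)) \<in> ?A"
      using uv vu subA csubspace_scaleR unfolding csubspace_def by blast
    then have b: "b \<in> G1" unfolding G1_eq b_def by (simp add: add.commute)
    have "(1/2) *\<^sub>R ((u, v) - (v, u)) \<in> ?A"
      using uv vu subA csubspace_scaleR csubspace_diff by blast
    moreover have "(1/2) *\<^sub>R (v - u) = - c" unfolding c_def by (simp add: algebra_simps)
    ultimately have c: "c \<in> G2" unfolding G2_eq c_def by simp
    have "b + c = u" unfolding b_def c_def by (simp add: scaleR_add_right[symmetric] scaleR_2[symmetric])
    then have "x = x0 + b + c" unfolding u_def by (simp add: algebra_simps)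
    moreover have "x0 \<in> Domain H0" using p p0 K_iff by blast
    ultimately show "x \<in> {a + b + c | a b c. a \<in> Domain H0 \<and> b \<in> G1 \<and> c \<in> G2}"
      using b c by blast
  next
    fix x assume "x \<in> {a + b + c | a b c. a \<in> Domain H0 \<and> b \<in> G1 \<and> c \<in> G2}"
    then obtain a b c where x: "x = a + b + c" "a \<in> Domain H0" "(b, b) \<in> ?A" "(c, - c) \<in> ?A"
      unfolding G1_eq G2_eq by blast
    obtain y where "(a, y) \<in> ?A" using D0A x(2) by blast
    then have "(a + b + c, y + b + - c) \<in> ?A" using x adjoint_op_add by blast
    then show "x \<in> Domain ?A" using x(1) by blast
  qed
  moreover have "a = 0 \<and> b = 0 \<and> c = 0"
    if a: "a \<in> Domain H0" and b: "b \<in> G1" and c: "c \<in> G2" and z: "a + b + c = 0" for a b c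
  proof -
    have b': "(b, b) \<in> ?A" and c': "(c, - c) \<in> ?A"
      using b c unfolding G1_eq G2_eq by blast+
    obtain y where y: "(a, y) \<in> ?A" "(a, y) \<in> K" using D0A a by blast
    have "(a + b + c, y + b + - c) \<in> ?A" using y b' c' adjoint_op_add by blast
    moreover have "(0, 0) \<in> ?A" using subA unfolding csubspace_def zero_prod_def by blast
    ultimately have "y + b + - c = 0" using sv z by metis
    then have y_eq: "y = - b + c" by (simp add: algebra_simps eq_neg_iff_add_eq_0)
    have a_eq: "a = - b - c" using z by (simp add: algebra_simps eq_neg_iff_add_eq_0)
    have H: "(a, - y) \<in> H0" using y K_iff by blast
    have 1: "cinner (- y) b = cinner a b" using b' H unfolding adjoint_op_iff by blast
    have 2: "cinner (- y) c = cinner a (- c)" using c' H unfolding adjoint_op_iff by blast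
    have "cinner b b = 0" "cinner c c = 0"
      using 1 2 unfolding y_eq a_eq by (auto simp: cinner_simps)
    then show ?thesis using a_eq by (simp add: cinner_self)
  qed
  ultimately show ?thesis unfolding direct_decomposition_def using D0 G1 G2 by blast
qed

end

lemma direct_components_eq:
  assumes "direct_decomposition V A B C" "a \<in> A" "b \<in> B" "c \<in> C"
  shows "direct_components A B C (a + b + c) = (a, b, c)"
  unfolding direct_components_def
proof (rule the_equality)
  show "case (a, b, c) of (a', b', c') \<Rightarrow> a' \<in> A \<and> b' \<in> B \<and> c' \<in> C \<and> a + b + c = a' + b' + c'"
    using assms by simp
  fix t assume t: "case t of (a', b', c') \<Rightarrow> a' \<in> A \<and> b' \<in> B \<and> c' \<in> C \<and> a + b + c = a' + b' + c'"
  obtain a' b' c' where t': "t = (a', b', c')" by (cases t)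
  have m: "a' \<in> A" "b' \<in> B" "c' \<in> C" and e: "a + b + c = a' + b' + c'" using t t' by auto
  have "(a - a') + (b - b') + (c - c') = 0" using e by (simp add: algebra_simps)
  then have "a - a' = 0 \<and> b - b' = 0 \<and> c - c' = 0"
    using assms m csubspace_diff unfolding direct_decomposition_def by metis
  then show "t = (a, b, c)" using t' by simp
qed

text \<open>The spaces, forms and map below always form a boundary system.\<close>

lemma (in skew_symmetric_op) boundary_system_kernels:
  defines "P1 \<equiv> \<lambda>x. fst (snd (direct_components (Domain H0) G1 G2 x))"
    and "P2 \<equiv> \<lambda>x. snd (snd (direct_components (Domain H0) G1 G2 x))"
  assumes F: "\<And>x y. (x, y) \<in> adjoint_op H0 \<Longrightarrow>
    F (x, y) = (complex_of_real (sqrt 2) *\<^sub>C P1 x, complex_of_real (sqrt 2) *\<^sub>C P2 x)"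
  shows "boundary_system H0 standard_symmetric_form G1 G2 F standard_unitary_form"
proof -
  let ?A = "adjoint_op H0" and ?r = "complex_of_real (sqrt 2)"
  note dd = decomposition[unfolded direct_decomposition_def]
  have subs: "csubspace (Domain H0)" "csubspace G1" "csubspace G2" using dd by blast+
  have rr: "?r * ?r = 2" by (simp flip: of_real_mult)
  have F_eq: "F (a + b + c, y) = (?r *\<^sub>C b, ?r *\<^sub>C c)"
    if "a \<in> Domain H0" "b \<in> G1" "c \<in> G2" "(a + b + c, y) \<in> ?A" for a b c y
    using F[OF that(4)] direct_components_eq[OF decomposition that(1-3)] unfolding P1_def P2_def by simp
  have sv: "z = z'" if "(y, z) \<in> ?A" "(y, z') \<in> ?A" for y z z'
    using that single_valued_adjoint_op[OF dense] unfolding single_valued_def by blast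
  have split: "\<exists>a b c w. (a, w) \<in> H0 \<and> b \<in> G1 \<and> c \<in> G2 \<and> p = (a + b + c, - w + b - c)"
    if p: "p \<in> ?A" for p
  proof -
    obtain x y where xy: "p = (x, y)" by force
    then have "x \<in> Domain ?A" using p by blast
    then obtain a b c where x: "x = a + b + c" "a \<in> Domain H0" "b \<in> G1" "c \<in> G2"
      using dd by blast
    obtain w where w: "(a, w) \<in> H0" using x by blast
    have "(a + b + c, - w + b + - c) \<in> ?A"
      using skew_symmetric_adjoint[OF skew w] x(3,4) adjoint_op_add
      unfolding G1_eq G2_eq by blast
    then have "y = - w + b - c" using sv p xy x(1) by auto
    then show ?thesis using xy x w by blast
  qed
  have green: "standard_symmetric_form p q = standard_unitary_form (F p) (F q)"
    if p: "p \<in> ?A" and q: "q \<in> ?A" for p q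
  proof -
    obtain a b c w where P: "(a, w) \<in> H0" "b \<in> G1" "c \<in> G2" "p = (a + b + c, - w + b - c)"
      using split p by blast
    obtain a' b' c' w' where Q: "(a', w') \<in> H0" "b' \<in> G1" "c' \<in> G2"
      "q = (a' + b' + c', - w' + b' - c')"
      using split q by blast
    have Gs: "(b, b) \<in> ?A" "(c, - c) \<in> ?A" "(b', b') \<in> ?A" "(c', - c') \<in> ?A"
      using P Q unfolding G1_eq G2_eq by blast+
    have "standard_unitary_form (F p) (F q) = 2 * cinner b b' - 2 * cinner c c'"
    proof -
      have "F p = (?r *\<^sub>C b, ?r *\<^sub>C c)" "F q = (?r *\<^sub>C b', ?r *\<^sub>C c')"
        using F_eq P Q p q by blast+
      then show ?thesis
        using rr by (simp add: standard_unitary_form_def cinner_simps mult.assoc[symmetric])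
    qed
    moreover have "cinner w a' = cinner a (- w')"
      using skew_symmetric_adjoint[OF skew Q(1)] P(1) unfolding adjoint_op_iff by blast
    moreover have "cinner w b' = cinner a b'" "cinner w c' = cinner a (- c')"
      using Gs P(1) unfolding adjoint_op_iff by blast+
    moreover have "cinner w' b = cinner a' b" "cinner w' c = cinner a' (- c)"
      using Gs Q(1) unfolding adjoint_op_iff by blast+
    then have "cinner b w' = cinner b a'" "cinner c w' = - cinner c a'"
      by (simp_all add: cinner_commute[of b w'] cinner_commute[of b a'] cinner_commute[of c w']
          cinner_commute[of c a'] cinner_minus_right)
    ultimately show ?thesis
      unfolding P(4) Q(4) standard_symmetric_form_def by (simp add: cinner_simps)
  qed
  have surj: "F ` ?A = G1 \<times> G2"
  proof (intro equalityI subsetI)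
    fix t assume "t \<in> F ` ?A"
    then obtain p where p: "p \<in> ?A" "t = F p" by blast
    obtain a b c w where P: "(a, w) \<in> H0" "b \<in> G1" "c \<in> G2" "p = (a + b + c, - w + b - c)"
      using split p by blast
    have "t = (?r *\<^sub>C b, ?r *\<^sub>C c)" using F_eq P p by blast
    then show "t \<in> G1 \<times> G2" using P subs csubspace_scaleC by blast
  next
    fix t assume "t \<in> G1 \<times> G2"
    then obtain b c where t: "t = (b, c)" "b \<in> G1" "c \<in> G2" by blast
    define b' c' where "b' = (1/?r) *\<^sub>C b" and "c' = (1/?r) *\<^sub>C c"
    have bc: "b' \<in> G1" "c' \<in> G2" 
      unfolding b'_def c'_def using t subs csubspace_scaleC by blast+
    have z: "0 \<in> Domain H0" using subs(1) by (rule csubspace_zero)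
    have "(b' + c', b' + - c') \<in> ?A"
      using bc adjoint_op_add unfolding G1_eq G2_eq by blast
    then have A: "(0 + b' + c', b' - c') \<in> ?A" by simp
    have one: "1 *\<^sub>C x = x" for x :: 'a using scaleC_of_real[of 1 x] by simp
    have "?r *\<^sub>C b' = b" "?r *\<^sub>C c' = c"
      unfolding b'_def c'_def by (simp_all add: scaleC_scaleC one)
    then have "F (0 + b' + c', b' - c') = t" using F_eq[OF z bc A] t by simp
    then show "t \<in> F ` ?A" using A by blast
  qed
  have cl: "closed G1" "closed G2"
  proof -
    have "G1 = (\<lambda>x. (x, x)) -` ?A" "G2 = (\<lambda>x. (x, - x)) -` ?A"
      unfolding G1_eq G2_eq by auto
    moreover have "continuous_on UNIV (\<lambda>x::'a. (x, x))" "continuous_on UNIV (\<lambda>x::'a. (x, - x))"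
      by (intro continuous_intros)+
    ultimately show "closed G1" "closed G2" using closed_adjoint_op closed_vimage by metis+
  qed
  have "sesquilinear_on UNIV (standard_symmetric_form :: 'a \<times> 'a \<Rightarrow> 'a \<times> 'a \<Rightarrow> complex)"
    "sesquilinear_on (G1 \<times> G2) (standard_unitary_form :: 'a \<times> 'a \<Rightarrow> 'a \<times> 'a \<Rightarrow> complex)"
    unfolding sesquilinear_on_def standard_symmetric_form_def standard_unitary_form_def
    by (auto simp: cinner_simps scaleC_prod_def algebra_simps)
  then show ?thesis unfolding boundary_system_def using green surj cl subs by blast
qed

end

theory Submission
  imports Defs
begin

text \<open>Skew-symmetry makes \<open>(x, y) \<mapsto> x + y\<close> isometric on the graph of \<open>H0\<close>, so the range of
  \<open>1 + H0\<close> is closed, and its orthogonal complement is the kernel \<open>G2\<close> of \<open>1 + H0\<^sup>\<star>\<close>.  Writing an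
  arbitrary vector as \<open>(a + H0 a) + v\<close> with \<open>v \<in> G2\<close> gives \<open>(1 - H) (a + v / 2)\<close>, because \<open>H\<close> acts
  as \<open>- H0\<close> on \<open>D(H0)\<close> and as \<open>- 1\<close> on \<open>G2\<close>.  So \<open>1 - H\<close> is surjective, which forces the
  dissipative operator \<open>H\<close> to be maximal.\<close>

lemma csubspace_Int: "csubspace A \<Longrightarrow> csubspace B \<Longrightarrow> csubspace (A \<inter> B)"
  unfolding csubspace_def by blast

lemma csubspace_sums:
  assumes A: "csubspace A" and B: "csubspace B"
  shows "csubspace {u + v | u v. u \<in> A \<and> v \<in> B}" (is "csubspace ?S")
  unfolding csubspace_def
proof (intro conjI ballI allI)
  show "0 \<in> ?S" using csubspace_zero[OF A] csubspace_zero[OF B] by force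
next
  fix x y assume "x \<in> ?S" "y \<in> ?S"
  then obtain u v u' v' where "u \<in> A" "v \<in> B" "u' \<in> A" "v' \<in> B" and xy: "x = u + v" "y = u' + v'"
    by blast
  then have "u + u' \<in> A" "v + v' \<in> B" using A B unfolding csubspace_def by blast+
  moreover have "x + y = (u + u') + (v + v')" unfolding xy by (simp add: algebra_simps)
  ultimately show "x + y \<in> ?S" by blast
next
  fix c x assume "x \<in> ?S"
  then show "c *\<^sub>C x \<in> ?S"
    using csubspace_scaleC[OF A] csubspace_scaleC[OF B] scaleC_add_right by blast
qed

text \<open>On a graph, this image is the range of \<open>1 +\<close> the operator; as a subspace it
  becomes a possible target of \<open>projection_exists\<close>.\<close>

lemma csubspace_image_add:
  assumes A: "csubspace A"
  shows "csubspace ((\<lambda>p. fst p + snd p) ` A)" (is "csubspace (?f ` A)")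
  unfolding csubspace_def
proof (intro conjI ballI allI)
  show "0 \<in> ?f ` A" using csubspace_zero[OF A] by force
next
  fix x y assume "x \<in> ?f ` A" "y \<in> ?f ` A"
  then obtain p q where pq: "p \<in> A" "q \<in> A" "x = ?f p" "y = ?f q" by blast
  then have "p + q \<in> A" using A unfolding csubspace_def by blast
  moreover have "x + y = ?f (p + q)" using pq by (simp add: algebra_simps)
  ultimately show "x + y \<in> ?f ` A" by blast
next
  fix c x assume "x \<in> ?f ` A"
  then obtain p where p: "p \<in> A" "x = ?f p" by blast
  moreover have "c *\<^sub>C x = ?f (c *\<^sub>C p)" using p by (simp add: scaleC_prod_def scaleC_add_right)
  ultimately show "c *\<^sub>C x \<in> ?f ` A" using csubspace_scaleC[OF A] by blast
qed

lemma csubspace_op_restrict: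
  assumes "csubspace A" "csubspace D"
  shows "csubspace (op_restrict A D)"
proof -
  have "csubspace {p. fst p \<in> D}"
    using assms(2) unfolding csubspace_def by (simp add: scaleC_prod_def)
  moreover have "op_restrict A D = A \<inter> {p. fst p \<in> D}" unfolding op_restrict_def by auto
  ultimately show ?thesis using assms(1) csubspace_Int by metis
qed

text \<open>Given \<open>(x, y)\<close> in a dissipative extension \<open>B\<close>, surjectivity
  yields \<open>(x', y')\<close> in \<open>A\<close> with the same difference. Linearity of
  \<open>B\<close> then makes it map \<open>x - x'\<close> to itself, and dissipativity excludes a
  nonzero fixed vector.\<close>

lemma maximal_dissipativeI:
  fixes A :: "('a::complex_hilbert \<times> 'a) set"
  assumes A: "dissipative A" and surj: "\<And>z. \<exists>(x, y) \<in> A. z = x - y"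
  shows "maximal_dissipative A"
  unfolding maximal_dissipative_def
proof (intro conjI allI impI)
  fix B :: "('a \<times> 'a) set" assume B: "dissipative B \<and> A \<subseteq> B"
  then have sub: "csubspace B" unfolding dissipative_def linear_op_def by blast
  have "(x, y) \<in> A" if xy: "(x, y) \<in> B" for x y
  proof -
    obtain x' y' where xy': "(x', y') \<in> A" "x - y = x' - y'" using surj[of "x - y"] by auto
    then have eq: "y - y' = x - x'" by (simp add: algebra_simps)
    have "(x - x', y - y') \<in> B" using csubspace_diff[OF sub xy, of "(x', y')"] xy' B by auto
    then have "Re (cinner (x - x') (x - x')) \<le> 0"
      using B unfolding dissipative_def eq by blast
    then have "x = x'" by (simp add: cinner_self)
    then show ?thesis using xy' eq by simp
  qed
  then show "B = A" using B by auto
qed (rule A)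

context skew_symmetric_op
begin

text \<open>Testing a graph element against itself in the adjoint relation shows that
  \<open>cinner w a\<close> is purely imaginary.\<close>

lemma Re_cinner_H0: "Re (cinner w a) = 0" if "(a, w) \<in> H0"
proof -
  have "cinner w a = cinner a (- w)"
    using skew_symmetric_adjoint[OF skew that] that unfolding adjoint_op_iff by blast
  then have "Re (cinner w a) = - Re (cinner a w)" by (simp add: cinner_minus_right)
  then show ?thesis by (simp add: Re_cinner_commute[of a w])
qed

text \<open>The cross term in \<open>norm_add_sq\<close> vanishes, and what remains is the norm on
  pairs.\<close>

lemma norm_add_H0: "norm (fst p + snd p) = norm p" if "p \<in> H0"
proof -
  have "Re (cinner (fst p) (snd p)) = 0"
    using Re_cinner_H0[of "fst p" "snd p"] that by (simp only: Re_cinner_commute[of "snd p"] prod.collapse)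
  then have "(norm (fst p + snd p))\<^sup>2 = (norm p)\<^sup>2" unfolding norm_add_sq norm_prod_def by simp
  then show ?thesis by (simp add: power2_eq_iff_nonneg)
qed

lemma range_one_plus:
  obtains a w v where "(a, w) \<in> H0" "v \<in> G2" "z = a + w + v"
proof -
  let ?f = "\<lambda>p::'a \<times> 'a. fst p + snd p"
  have sub: "csubspace H0" using lin unfolding linear_op_def by blast
  have "subspace H0"
    unfolding subspace_def using sub csubspace_scaleR csubspace_def by blast
  moreover have "bounded_linear ?f"
    by (intro bounded_linear_add bounded_linear_fst bounded_linear_snd)
  \<comment> \<open>The graph is closed in a Hilbert space, hence complete, and an isometry
    (constant 1) preserves completeness.\<close>
  ultimately have "complete (?f ` H0)"
    using complete_isometric_image[of 1 H0 ?f] norm_add_H0 closed_H0 by (simp add: complete_eq_closed)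
  then have "closed (?f ` H0)" by (simp only: complete_eq_closed)
  then obtain p where p: "p \<in> ?f ` H0" "\<And>s. s \<in> ?f ` H0 \<Longrightarrow> cinner (z - p) s = 0"
    using projection_exists[OF csubspace_image_add[OF sub], of z] by blast
  obtain a w where aw: "(a, w) \<in> H0" "p = a + w" using p(1) by auto
  \<comment> \<open>Orthogonality of \<open>z - p\<close> to every \<open>x + y\<close> with
    \<open>(x, y)\<close> in \<open>H0\<close> is exactly the adjoint relation for
    \<open>(z - p, - (z - p))\<close>.\<close>
  have "z - p \<in> G2"
    unfolding G2_eq mem_Collect_eq adjoint_op_iff
  proof (intro allI impI)
    fix x y assume "(x, y) \<in> H0"
    then have "x + y \<in> ?f ` H0" by force
    then have "cinner (x + y) (z - p) = 0" using p(2) cinner_commute[of "x + y" "z - p"] by simp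
    then show "cinner y (z - p) = cinner x (- (z - p))"
      by (simp only: cinner_add_left cinner_minus_right eq_neg_iff_add_eq_0 add.commute)
  qed
  then show ?thesis using that[OF aw(1), of "z - p"] aw(2) by simp
qed

text \<open>Skew-symmetry gives the action on \<open>Domain H0\<close> and the definition of
  \<open>G2\<close> the action there; density makes the adjoint single-valued, so no other values
  occur.\<close>

lemma restrict_adjoint_eq:
  "op_restrict (adjoint_op H0) {u + v | u v. u \<in> Domain H0 \<and> v \<in> G2} =
    {(a + v, - w - v) | a w v. (a, w) \<in> H0 \<and> v \<in> G2}" (is "?L = ?R")
proof -
  have A: "(a + v, - w - v) \<in> adjoint_op H0" if "(a, w) \<in> H0" "v \<in> G2" for a w v
    using adjoint_op_add[OF skew_symmetric_adjoint[OF skew that(1)], of v "- v"] that(2)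
    unfolding G2_eq by simp
  show ?thesis
  proof (intro equalityI subsetI)
    fix p assume "p \<in> ?L"
    then obtain a w v y where p: "p = (a + v, y)" "(a + v, y) \<in> adjoint_op H0"
      and av: "(a, w) \<in> H0" "v \<in> G2"
      unfolding op_restrict_def by blast
    then have "y = - w - v"
      using A[OF av] single_valued_adjoint_op[OF dense] unfolding single_valued_def by blast
    then show "p \<in> ?R" using p(1) av by blast
  next
    fix p assume "p \<in> ?R"
    then show "p \<in> ?L" unfolding op_restrict_def using A by blast
  qed
qed

lemma maximal_dissipative_restrict_adjoint:
  "maximal_dissipative (op_restrict (adjoint_op H0) {u + v | u v. u \<in> Domain H0 \<and> v \<in> G2})"
  (is "maximal_dissipative ?H")
proof (rule maximal_dissipativeI)
  have "csubspace (Domain H0)" "csubspace G2"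
    using decomposition unfolding direct_decomposition_def by blast+
  then have "csubspace ?H"
    by (intro csubspace_op_restrict csubspace_adjoint_op csubspace_sums)
  moreover have "single_valued ?H"
    using single_valued_adjoint_op[OF dense] unfolding single_valued_def op_restrict_def by blast
  moreover have "Re (cinner y x) \<le> 0" if xy: "(x, y) \<in> ?H" for x y
  proof -
    obtain a w v where x: "x = a + v" "y = - w - v" "(a, w) \<in> H0" "v \<in> G2"
      using xy unfolding restrict_adjoint_eq by blast
    \<comment> \<open>Since \<open>v\<close> lies in \<open>G2\<close>, this identity cancels the
      real parts of the mixed terms in \<open>cinner y x\<close>, leaving only the contribution of
      \<open>v\<close>.\<close>
    then have "cinner w v = - cinner a v"
      unfolding G2_eq adjoint_op_iff by (simp add: cinner_minus_right)
    then have "Re (cinner y x) = - Re (cinner v v)"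
      using Re_cinner_H0[OF x(3)]
      unfolding x(1,2) by (simp add: cinner_simps Re_cinner_commute[of v a])
    then show ?thesis by (simp add: cinner_self)
  qed
  ultimately show "dissipative ?H" unfolding dissipative_def linear_op_def by blast
next
  fix z
  obtain a w v where z: "(a, w) \<in> H0" "v \<in> G2" "z = a + w + v" by (rule range_one_plus)
  \<comment> \<open>The factor 1/2 compensates for \<open>1 - H\<close> doubling the vectors of
    \<open>G2\<close>.\<close>
  let ?v = "(1/2) *\<^sub>R v"
  have "csubspace G2" using decomposition unfolding direct_decomposition_def by blast
  then have "?v \<in> G2" using z(2) by (rule csubspace_scaleR)
  then have "(a + ?v, - w - ?v) \<in> ?H" unfolding restrict_adjoint_eq using z(1) by blast
  moreover have "z = (a + ?v) - (- w - ?v)"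
    using scaleR_half_double[of v] unfolding z(3) by (simp add: algebra_simps scaleR_2)
  ultimately show "\<exists>(x, y) \<in> ?H. z = x - y" by blast
qed

text \<open>These are the elements of \<open>restrict_adjoint_eq\<close> with zero component in
  \<open>G2\<close>.\<close>

lemma uminus_subset_restrict_adjoint:
  "op_uminus H0 \<subseteq> op_restrict (adjoint_op H0) {u + v | u v. u \<in> Domain H0 \<and> v \<in> G2}"
proof -
  have "csubspace G2" using decomposition unfolding direct_decomposition_def by blast
  then have G2: "0 \<in> G2" by (rule csubspace_zero)
  show ?thesis
  proof
    fix p assume "p \<in> op_uminus H0"
    then obtain x y where "p = (x + 0, - y - 0)" "(x, y) \<in> H0"
      unfolding op_uminus_def by auto
    then show "p \<in> op_restrict (adjoint_op H0) {u + v | u v. u \<in> Domain H0 \<and> v \<in> G2}"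
      using G2 unfolding restrict_adjoint_eq by blast
  qed
qed

end

text \<open>The extended operator is \<open>- H0\<close>: by
  \<open>skew_symmetric_eq_zero_if_extended_by_adjoint\<close>, a restriction of the adjoint extends
  \<open>H0\<close> itself only if \<open>H0\<close> vanishes on its domain.\<close>

theorem corollary7:
  fixes H0 H :: "('a::complex_hilbert \<times> 'a) set"
    and \<Omega> \<omega> :: "'a \<times> 'a \<Rightarrow> 'a \<times> 'a \<Rightarrow> complex"
    and G1 G2 :: "'a set"
    and P1 P2 :: "'a \<Rightarrow> 'a"
    and F :: "'a \<times> 'a \<Rightarrow> 'a \<times> 'a"
  assumes "linear_op H0" and "densely_defined H0" and "closed H0" and "skew_symmetric H0"
    and "G1 = op_kernel (op_plus Id (op_uminus (adjoint_op H0)))"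
    and "G2 = op_kernel (op_plus Id (adjoint_op H0))"
    and "\<Omega> = standard_symmetric_form"
    and "\<omega> = standard_unitary_form"
    and "\<forall>x \<in> Domain (adjoint_op H0). P1 x = fst (snd (direct_components (Domain H0) G1 G2 x))"
    and "\<forall>x \<in> Domain (adjoint_op H0). P2 x = snd (snd (direct_components (Domain H0) G1 G2 x))"
    and "\<forall>(x, y) \<in> adjoint_op H0.
           F (x, y) = (complex_of_real (sqrt 2) *\<^sub>C P1 x, complex_of_real (sqrt 2) *\<^sub>C P2 x)"
    and "boundary_system H0 \<Omega> G1 G2 F \<omega>"
    and "H = op_restrict (adjoint_op H0) {u + v | u v. u \<in> Domain H0 \<and> v \<in> G2}"
  shows "maximal_dissipative H \<and> op_uminus H0 \<subseteq> H"
proof -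
  interpret skew_symmetric_op H0 using assms(1-4) by unfold_locales
  show ?thesis
    unfolding assms(13) assms(6)
    using maximal_dissipative_restrict_adjoint uminus_subset_restrict_adjoint by blast
qed

end
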